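(* For every integer $b\ge2$ and every $\varepsilon>0$, there exists an election $E=(N,C,A,k)$ with $k=1$ and maximum ballot size $\max_{i\in N}|A_i|=b$ for which $\operatorname{PAV}(W)<\left(\frac1b+\varepsilon\right)\operatorname{OPT}_1$, where $W$ is the committee returned by Reverse Sequential PAV on $E$.
   Context: An election is a tuple $E=(N,C,A,k)$, where $N=\{1,\ldots,n\}$ is a set of voters, $C$ is a set of $m$ candidates, $A=(A_i)_{i\in N}$ is a profile of approval ballots $A_i\subseteq C$, and $k$ is the desired committee size. It is assumed that $1\le k<m$ and that $A_i\ne\emptyset$ for at least one voter $i$. A committee is a set $W\subseteq C$ with $|W|=k$. For an integer $t\ge 0$, $H(t)=\sum_{j=1}^{t}1/j$ (so $H(0)=0$). For $S\subseteq C$, $\operatorname{PAV}(S)=\sum_{i\in N}H(|A_i\cap S|)$, and for $c\in S$ the marginal loss is $\Delta_S(c)=\operatorname{PAV}(S)-\operatorname{PAV}(S\setminus\{c\})$. $\operatorname{OPT}_k$ is the maximum of $\operatorname{PAV}(W')$ over all committees $W'\subseteq C$ with $|W'|=k$. Reverse Sequential PAV: let $C_m=C$; for $s=m,m-1,\ldots,k+1$ pick $c_s\in\arg\min_{c\in C_s}\Delta_{C_s}(c)$ and set $C_{s-1}=C_s\setminus\{c_s\}$; return $W=C_k$. Ties are resolved using a fixed priority (linear) order on candidates. *)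

theory Defs
  imports "HOL-Analysis.Analysis"
begin

record 'c election =
  voters :: "nat set"
  cands :: "'c set"
  ballot :: "nat \<Rightarrow> 'c set"
  csize :: nat

(* Only the values of ballot on the voters matter; other values are unconstrained and unused. *)
definition valid_election :: "'c election \<Rightarrow> bool" where
  "valid_election E \<longleftrightarrow>
     (\<exists>n. voters E = {1..n}) \<and>
     finite (cands E) \<and>
     (\<forall>i\<in>voters E. ballot E i \<subseteq> cands E) \<and>
     1 \<le> csize E \<and> csize E < card (cands E) \<and>
     (\<exists>i\<in>voters E. ballot E i \<noteq> {})"

definition max_ballot_size :: "'c election \<Rightarrow> nat" where
  "max_ballot_size E = Max ((\<lambda>i. card (ballot E i)) ` voters E)"

definition PAV :: "'c election \<Rightarrow> 'c set \<Rightarrow> real" where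
  "PAV E S = (\<Sum>i\<in>voters E. harm (card (ballot E i \<inter> S)))"

definition marginal_loss :: "'c election \<Rightarrow> 'c set \<Rightarrow> 'c \<Rightarrow> real" where
  "marginal_loss E S c = PAV E S - PAV E (S - {c})"

definition OPT :: "'c election \<Rightarrow> nat \<Rightarrow> real" where
  "OPT E j = Max {PAV E W' | W'. W' \<subseteq> cands E \<and> card W' = j}"

definition least_loss :: "'c election \<Rightarrow> 'c set \<Rightarrow> 'c set" where
  "least_loss E S = {c. is_arg_min (marginal_loss E S) (\<lambda>d. d \<in> S) c}"

(* (c, d) \<in> r means that c precedes d in the priority order: among tied candidates the
   r-first one is deleted. *)
definition deleted_cand :: "'c election \<Rightarrow> 'c rel \<Rightarrow> 'c set \<Rightarrow> 'c" where
  "deleted_cand E r S =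
     (THE c. c \<in> least_loss E S \<and> (\<forall>d\<in>least_loss E S. (c, d) \<in> r))"

(* remaining E r j is the set left after j deletions, i.e. C_s for s = m - j. *)
primrec remaining :: "'c election \<Rightarrow> 'c rel \<Rightarrow> nat \<Rightarrow> 'c set" where
  "remaining E r 0 = cands E"
| "remaining E r (Suc j) =
     remaining E r j - {deleted_cand E r (remaining E r j)}"

definition rev_seq_PAV :: "'c election \<Rightarrow> 'c rel \<Rightarrow> 'c set" where
  "rev_seq_PAV E r = remaining E r (card (cands E) - csize E)"

lemma deleted_cand_least_loss:
  assumes "linear_order_on C r" "S \<subseteq> C" "finite S" "S \<noteq> {}"
  shows "deleted_cand E r S \<in> least_loss E S \<and>
         (\<forall>d\<in>least_loss E S. (deleted_cand E r S, d) \<in> r)"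
proof -
  let ?L = "least_loss E S"
  have sub: "?L \<subseteq> S"
    by (auto simp: least_loss_def is_arg_min_def)
  obtain c where "is_arg_min (marginal_loss E S) (\<lambda>d. d \<in> S) c"
    using ex_is_arg_min_if_finite[OF assms(3,4)] by blast
  then have ne: "?L \<noteq> {}"
    by (auto simp: least_loss_def)
  have fin: "finite ?L"
    using sub assms(3) finite_subset by blast
  have refl: "\<And>a. a \<in> C \<Longrightarrow> (a, a) \<in> r" and tr: "trans r" and an: "antisym r" and tot: "total_on C r"
    using assms(1)
    by (auto simp: linear_order_on_def partial_order_on_def preorder_on_def refl_on_def)
  have "\<exists>c\<in>T. \<forall>d\<in>T. (c, d) \<in> r" if "finite T" "T \<noteq> {}" "T \<subseteq> C" for T
    using that
  proof (induction rule: finite_ne_induct)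
    case (singleton x)
    then show ?case using refl by auto
  next
    case (insert x F)
    then obtain c where c: "c \<in> F" "\<forall>d\<in>F. (c, d) \<in> r" by auto
    have x: "x \<in> C" and "c \<in> C" "x \<noteq> c" using insert c by auto
    then have "(x, c) \<in> r \<or> (c, x) \<in> r"
      using tot by (auto simp: total_on_def)
    then show ?case
    proof
      assume "(x, c) \<in> r"
      then have "\<forall>d\<in>insert x F. (x, d) \<in> r"
        using c refl[OF x] tr by (auto dest: transD)
      then show ?thesis by blast
    next
      assume "(c, x) \<in> r"
      then show ?thesis using c by auto
    qed
  qed
  then obtain c where c: "c \<in> ?L" "\<forall>d\<in>?L. (c, d) \<in> r"
    using fin ne sub assms(2) by (meson subset_trans)
  show ?thesis
    unfolding deleted_cand_def
    by (rule theI[of _ c]) (use c an in \<open>auto dest: antisymD\<close>)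
qed

lemma rev_seq_PAV_committee:
  assumes "valid_election E" "linear_order_on (cands E) r"
  shows "rev_seq_PAV E r \<subseteq> cands E \<and> card (rev_seq_PAV E r) = csize E"
proof -
  have fin: "finite (cands E)" and k: "csize E < card (cands E)"
    using assms(1) by (auto simp: valid_election_def)
  have "remaining E r j \<subseteq> cands E \<and> card (remaining E r j) = card (cands E) - j"
    if "j \<le> card (cands E)" for j
    using that
  proof (induction j)
    case 0
    then show ?case by simp
  next
    case (Suc j)
    let ?S = "remaining E r j"
    have S: "?S \<subseteq> cands E" "card ?S = card (cands E) - j"
      using Suc by auto
    then have "?S \<noteq> {}" "finite ?S"
      using Suc.prems fin finite_subset by auto
    then have "deleted_cand E r ?S \<in> ?S"
      using deleted_cand_least_loss[OF assms(2) S(1)]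
      by (auto simp: least_loss_def is_arg_min_def)
    then show ?case
      using S \<open>finite ?S\<close> by auto
  qed
  from this[of "card (cands E) - csize E"] show ?thesis
    using k by (simp add: rev_seq_PAV_def)
qed

end

(* Let q be large. One popular candidate is approved by b q voters, each of whom also approves b - 1
   private candidates of their own; every private candidate is additionally approved by q voters
   who approve nobody else. The popular candidate has marginal loss b q / b = q, every private one
   has q + 1/b, so the popular one is deleted first. The winner then has only q + 1 approvals,
   while the optimum is at least b q. *)
theory Submission
  imports Defs
begin

text \<open>Deleting \<open>c\<close> shrinks the intersection by one for exactly the approvers of
  \<open>c\<close>, and consecutive harmonic numbers H(t) and H(t-1) differ by 1/t.\<close>

lemma marginal_loss_eq:
  assumes "finite (voters E)" "finite S" "c \<in> S"
  shows "marginal_loss E S c = (\<Sum>i | i \<in> voters E \<and> c \<in> ballot E i. 1 / card (ballot E i \<inter> S))"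
proof -
  have loss: "harm (card (ballot E i \<inter> S)) - harm (card (ballot E i \<inter> (S - {c})))
      = (if c \<in> ballot E i then 1 / card (ballot E i \<inter> S) else (0::real))" for i
  proof (cases "c \<in> ballot E i")
    case True
    then have "ballot E i \<inter> S = insert c (ballot E i \<inter> (S - {c}))"
      using assms by auto
    then have "card (ballot E i \<inter> S) = Suc (card (ballot E i \<inter> (S - {c})))"
      using assms by (metis Diff_iff Int_iff card_insert_disjoint finite_Diff finite_Int insertI1)
    then show ?thesis
      using True by (simp add: harm_Suc field_simps)
  next
    case False
    then have "ballot E i \<inter> S = ballot E i \<inter> (S - {c})" by auto
    then show ?thesis using False by simp
  qed
  show ?thesis
    unfolding marginal_loss_def PAV_def sum_subtractf[symmetric] loss
    by (rule sum.inter_filter[symmetric]) (rule assms)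
qed

lemma PAV_singleton:
  assumes "finite (voters E)"
  shows "PAV E {c} = card {i \<in> voters E. c \<in> ballot E i}"
proof -
  have "harm (card (ballot E i \<inter> {c})) = (if c \<in> ballot E i then 1 else (0::real))" for i
    by (simp add: harm_def)
  then show ?thesis
    using assms by (simp add: PAV_def sum.inter_filter[symmetric])
qed

lemma PAV_le_OPT:
  assumes "finite (cands E)" "W \<subseteq> cands E" "card W = j"
  shows "PAV E W \<le> OPT E j"
proof -
  have "{PAV E W' | W'. W' \<subseteq> cands E \<and> card W' = j} \<subseteq> PAV E ` Pow (cands E)"
    by auto
  then have "finite {PAV E W' | W'. W' \<subseteq> cands E \<and> card W' = j}"
    using assms(1) by (meson finite_Pow_iff finite_imageI finite_subset)
  then show ?thesis
    unfolding OPT_def using assms by (intro Max_ge) auto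
qed

lemma remaining_antimono: "i \<le> j \<Longrightarrow> remaining E r j \<subseteq> remaining E r i"
  by (induction rule: dec_induct) auto

text \<open>A strict minimiser leaves no tie, so every priority order deletes \<open>a\<close> in
  the first round, and deleted candidates never return.\<close>

lemma strict_least_loss_not_in_rev_seq_PAV:
  assumes "valid_election E" "linear_order_on (cands E) r" "a \<in> cands E"
    and less: "\<And>d. d \<in> cands E \<Longrightarrow> d \<noteq> a \<Longrightarrow>
      marginal_loss E (cands E) a < marginal_loss E (cands E) d"
  shows "a \<notin> rev_seq_PAV E r"
proof -
  have "deleted_cand E r (cands E) \<in> least_loss E (cands E)"
    using deleted_cand_least_loss[OF assms(2) subset_refl] assms(1,3)
    by (auto simp: valid_election_def)
  then have "deleted_cand E r (cands E) = a"
    using assms(3) less by (force simp: least_loss_def is_arg_min_def)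
  then have "a \<notin> remaining E r (Suc 0)" by simp
  \<comment> \<open>Since k < m, at least one round takes place.\<close>
  moreover have "Suc 0 \<le> card (cands E) - csize E"
    using assms(1) by (auto simp: valid_election_def)
  ultimately show ?thesis
    unfolding rev_seq_PAV_def by (meson remaining_antimono subsetD)
qed

(* Candidate 0 is the popular one; c = b - 1 is the number of private candidates per voter. *)
definition bad_election :: "nat \<Rightarrow> nat \<Rightarrow> nat election" where
  "bad_election c q = (let N = Suc c * q in
     \<lparr>voters = {1..N + N * c * q},
      cands = {0..N * c},
      ballot = (\<lambda>i. if i \<le> N then insert 0 (Suc ` {(i - 1) * c..<(i - 1) * c + c})
                    else {Suc ((i - N - 1) div q)}),
      csize = 1\<rparr>)"

text \<open>Consecutive blocks of equal length partition the naturals. Length \<open>c\<close> will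
  identify the owner of a private candidate, length \<open>q\<close> its additional
  supporters.\<close>

lemma in_block_iff:
  fixes c :: nat
  assumes "c > 0"
  shows "e \<in> {i * c..<i * c + c} \<longleftrightarrow> i = e div c"
  using assms by (auto simp: div_nat_eqI algebra_simps times_div_less_eq_dividend dividend_less_times_div)

context
  fixes c q N :: nat and E :: "nat election"
  assumes c: "c > 0" and q: "q > 0"
  defines "N \<equiv> Suc c * q" and "E \<equiv> bad_election c q"
begin

lemma voters_E: "voters E = {1..N + N * c * q}"
  and cands_E: "cands E = {0..N * c}"
  and csize_E: "csize E = 1"
  and ballot_E: "ballot E i = (if i \<le> N then insert 0 (Suc ` {(i - 1) * c..<(i - 1) * c + c})
                    else {Suc ((i - N - 1) div q)})"
  by (simp_all add: E_def bad_election_def N_def Let_def)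

lemma N_pos: "N > 0"
  using q by (simp add: N_def)

lemma ballot_subset: "i \<in> voters E \<Longrightarrow> ballot E i \<subseteq> cands E"
proof (cases "i \<le> N")
  case True
  assume "i \<in> voters E"
  \<comment> \<open>Voters are numbered from 1, so the subtraction does not truncate.\<close>
  then have "(i - 1) * c + c = i * c"
    by (cases i) (auto simp: voters_E)
  also have "\<dots> \<le> N * c" using True by simp
  finally show ?thesis using True by (auto simp: ballot_E cands_E)
next
  case False
  assume "i \<in> voters E"
  then have "i - N - 1 < N * c * q" using False by (auto simp: voters_E)
  then have "(i - N - 1) div q < N * c" by (simp add: less_mult_imp_div_less)
  then show ?thesis using False by (auto simp: ballot_E cands_E)
qed

lemma card_ballot: "card (ballot E i) = (if i \<le> N then Suc c else 1)"
  by (auto simp: ballot_E card_insert_disjoint card_image)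

lemma approvers_0: "{i \<in> voters E. 0 \<in> ballot E i} = {1..N}"
  by (auto simp: voters_E ballot_E)

lemma approvers_Suc:
  assumes "e < N * c"
  shows "{i \<in> voters E. Suc e \<in> ballot E i}
    = insert (Suc (e div c)) {Suc N + e * q..<Suc N + e * q + q}"
proof -
  have "e div c < N" using assms by (simp add: less_mult_imp_div_less)
  \<comment> \<open>The whole block of additional supporters thus fits into the voter range.\<close>
  moreover have "Suc e * q \<le> N * c * q" using assms by (simp only: mult_le_mono1 Suc_leI)
  moreover have "i \<in> voters E \<and> Suc e \<in> ballot E i \<longleftrightarrow> i \<in> voters E \<and> i = Suc (e div c)"
    if "i \<le> N" for i
    using that in_block_iff[OF c, of e "i - 1"]
    by (cases i) (auto simp: ballot_E voters_E image_iff)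
  moreover have "i \<in> voters E \<and> Suc e \<in> ballot E i \<longleftrightarrow>
      i \<in> voters E \<and> i \<in> {Suc N + e * q..<Suc N + e * q + q}"
    if "i > N" for i
  proof -
    \<comment> \<open>This form reduces \<open>i - N - 1\<close> to \<open>j\<close>, so the block
      lemma applies with length \<open>q\<close>.\<close>
    obtain j where "i = Suc (N + j)" using less_imp_Suc_add[OF \<open>i > N\<close>] by auto
    then show ?thesis using in_block_iff[OF q, of j e] by (simp add: ballot_E add.assoc)
  qed
  ultimately have "i \<in> voters E \<and> Suc e \<in> ballot E i \<longleftrightarrow>
      i \<in> insert (Suc (e div c)) {Suc N + e * q..<Suc N + e * q + q}" for i
    by (cases "i \<le> N") (auto simp: voters_E)
  then show ?thesis by blast
qed

lemma valid_E: "valid_election E"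
proof -
  have "1 < card (cands E)"
    using c N_pos by (simp add: cands_E)
  moreover have "\<exists>i\<in>voters E. ballot E i \<noteq> {}"
    using N_pos by (intro bexI[of _ 1]) (auto simp: ballot_E voters_E)
  ultimately show ?thesis
    using ballot_subset by (auto simp: valid_election_def csize_E voters_E cands_E)
qed

lemma max_ballot_E: "max_ballot_size E = Suc c"
  unfolding max_ballot_size_def
proof (rule Max_eqI)
  show "Suc c \<in> (\<lambda>i. card (ballot E i)) ` voters E"
    using N_pos by (intro image_eqI[of _ _ 1]) (auto simp: card_ballot voters_E)
qed (auto simp: card_ballot voters_E split: if_splits)

lemma marginal_loss_E:
  assumes "d \<in> cands E"
  shows "marginal_loss E (cands E) d
    = (\<Sum>i | i \<in> voters E \<and> d \<in> ballot E i. if i \<le> N then 1 / Suc c else 1)"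
proof -
  have "finite (voters E)" "finite (cands E)" by (simp_all add: voters_E cands_E)
  then show ?thesis
    using assms by (auto intro!: sum.cong simp: marginal_loss_eq Int_absorb2[OF ballot_subset] card_ballot)
qed

text \<open>Each of the \<open>N\<close> approvers contributes \<open>1 / Suc c\<close>; the choice
  \<open>N = Suc c * q\<close> makes the total an integer just below the private losses.\<close>

lemma marginal_loss_0: "marginal_loss E (cands E) 0 = q"
  by (subst marginal_loss_E) (auto simp: cands_E approvers_0 N_def field_simps)

text \<open>The \<open>q\<close> singleton ballots contribute 1 each. The owner's share
  \<open>1 / Suc c\<close> is the whole gap to candidate 0 and makes the comparison strict.\<close>

lemma marginal_loss_Suc:
  assumes "e < N * c"
  shows "marginal_loss E (cands E) (Suc e) = q + 1 / Suc c"
proof -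
  \<comment> \<open>The owner \<open>Suc (e div c)\<close> is at most \<open>N\<close>, hence
    outside the block starting at \<open>Suc N + e * q\<close>.\<close>
  have "e div c < N" using assms by (simp add: less_mult_imp_div_less)
  then show ?thesis
    using assms
    by (subst marginal_loss_E) (auto simp: cands_E approvers_Suc)
qed

text \<open>Once candidate 0 is gone, it does not matter who survives: all private candidates have
  equally many approvers.\<close>

lemma PAV_rev_seq_PAV_E:
  assumes "linear_order_on (cands E) r"
  shows "PAV E (rev_seq_PAV E r) = q + 1"
proof -
  have "0 \<notin> rev_seq_PAV E r"
  proof (rule strict_least_loss_not_in_rev_seq_PAV[OF valid_E assms])
    fix d assume "d \<in> cands E" "d \<noteq> 0"
    then obtain e where "d = Suc e" "e < N * c" by (cases d) (auto simp: cands_E)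
    then show "marginal_loss E (cands E) 0 < marginal_loss E (cands E) d"
      by (simp add: marginal_loss_0 marginal_loss_Suc)
  qed (simp add: cands_E)
  moreover have "rev_seq_PAV E r \<subseteq> cands E" "card (rev_seq_PAV E r) = 1"
    using rev_seq_PAV_committee[OF valid_E assms] by (auto simp: csize_E)
  ultimately obtain d where W: "rev_seq_PAV E r = {d}" "d \<noteq> 0" "d \<le> N * c"
    by (auto simp: card_1_singleton_iff cands_E)
  then obtain e where e: "d = Suc e" "e < N * c" by (cases d) auto
  then have "e div c < N" by (simp add: less_mult_imp_div_less)
  moreover have "finite (voters E)" by (simp add: voters_E)
  ultimately show ?thesis
    using e by (simp add: W(1) PAV_singleton approvers_Suc)
qed

text \<open>The committee \<open>{0}\<close> witnesses the bound.\<close>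

lemma OPT_E_ge: "real (Suc c * q) \<le> OPT E 1"
proof -
  have "PAV E {0} = N"
    by (subst PAV_singleton) (simp add: voters_E, simp add: approvers_0)
  moreover have "PAV E {0} \<le> OPT E 1"
    by (rule PAV_le_OPT) (auto simp: cands_E)
  ultimately show ?thesis by (simp only: N_def)
qed

end

theorem theorem10:
  fixes b :: nat and \<epsilon> :: real
  assumes "b \<ge> 2" and "\<epsilon> > 0"
  shows "\<exists>E :: nat election.
           valid_election E \<and> csize E = 1 \<and> max_ballot_size E = b \<and>
           (\<forall>r. linear_order_on (cands E) r \<longrightarrow>
                PAV E (rev_seq_PAV E r) < (1 / real b + \<epsilon>) * OPT E 1)"
proof -
  obtain c where c: "b = Suc c" "c > 0"
    using assms(1) by (cases b) auto
  \<comment> \<open>The target \<open>(1 / b + \<epsilon>) * (b * q)\<close> equals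
    \<open>q + b * \<epsilon> * q\<close>, so it exceeds \<open>q + 1\<close> exactly when
    \<open>b * \<epsilon> * q > 1\<close>.\<close>
  obtain q :: nat where q0: "1 / (b * \<epsilon>) < q"
    using reals_Archimedean2 by blast
  then have q: "1 < b * \<epsilon> * q"
    using assms by (simp add: field_simps)
  then have "q > 0" by (cases q) auto
  let ?E = "bad_election c q"
  have "q + 1 < (1 / b + \<epsilon>) * (b * q)"
    using q assms(1) by (simp add: field_simps)
  also have "\<dots> \<le> (1 / b + \<epsilon>) * OPT ?E 1"
    using OPT_E_ge[OF \<open>c > 0\<close> \<open>q > 0\<close>] assms c(1) by (intro mult_left_mono) auto
  finally show ?thesis
    using valid_E[OF \<open>c > 0\<close> \<open>q > 0\<close>] csize_E[OF \<open>c > 0\<close> \<open>q > 0\<close>] max_ballot_E[OF \<open>c > 0\<close> \<open>q > 0\<close>]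
      PAV_rev_seq_PAV_E[OF \<open>c > 0\<close> \<open>q > 0\<close>] c(1)
    by (intro exI[of _ ?E]) auto
qed

end
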